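(* Fix an integer $p\ge2$, and let $q$ be the function whose graph $\beta_2=q(\beta_1)$ is the phase transition curve, with critical point $(\beta_1^c,\beta_2^c)$. For $\beta_1<\beta_1^c$ let $x_1^*<x_2^*$ be the two global maximizers of $\ell$ at parameters $(\beta_1,q(\beta_1))$. (i) $q(\beta_1)$ is differentiable for $\beta_1<\beta_1^c$ with $$q'(\beta_1)=-\frac{x_1^*-x_2^*}{(x_1^* )^p-(x_2^* )^p}<0.$$ In particular, $$\lim_{\beta_1\to\beta_1^c}q'(\beta_1)=-\frac{p^{p-2}}{(p-1)^{p-1}}\qquad\text{and}\qquad\lim_{\beta_1\to-\infty}q'(\beta_1)=-1,$$ where the first limit is taken through $\beta_1<\beta_1^c$. (ii) $q(\beta_1)$ is convex in $\beta_1$ (for $\beta_1<\beta_1^c$).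
   Context: For real $\beta_1,\beta_2$, $\ell:[0,1]\to\mathbb{R}$ is $\ell(x)=\beta_1x+\beta_2x^p-x\log x-(1-x)\log(1-x)$ (with $0\log0=0$). Phase transition curve: by a known result of Radin and Yin there is a curve in the $(\beta_1,\beta_2)$-plane, of the form $\beta_2=q(\beta_1)$ for $\beta_1\le\beta_1^c$, with endpoint (the critical point) $$(\beta_1^c,\beta_2^c)=\left(\log(p-1)-\frac{p}{p-1},\ \frac{p^{p-1}}{(p-1)^p}\right),$$ such that off the curve and at the endpoint $\ell$ has a unique global maximizer $x^*\in(0,1)$, while on the curve away from the endpoint $\ell$ has exactly two global maximizers $x_1^*,x_2^*$, with $0<x_1^*<\frac{p-1}{p}<x_2^*<1$. *)

theory Defs
  imports "HOL-Analysis.Analysis"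
begin

(* At x = 0 and x = 1 the factors x and 1 - x vanish, so that 0 log 0 = 0. *)
definition ell :: "nat \<Rightarrow> real \<Rightarrow> real \<Rightarrow> real \<Rightarrow> real" where
  "ell p \<beta>1 \<beta>2 x = \<beta>1 * x + \<beta>2 * x ^ p - x * ln x - (1 - x) * ln (1 - x)"

definition global_maximizers :: "nat \<Rightarrow> real \<Rightarrow> real \<Rightarrow> real set" where
  "global_maximizers p \<beta>1 \<beta>2 = {x. is_arg_max (ell p \<beta>1 \<beta>2) (\<lambda>x. x \<in> {0..1}) x}"

definition beta1_crit :: "nat \<Rightarrow> real" where
  "beta1_crit p = ln (real p - 1) - real p / (real p - 1)"

definition beta2_crit :: "nat \<Rightarrow> real" where
  "beta2_crit p = real p ^ (p - 1) / (real p - 1) ^ p"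

(* The curve is the graph of q over {..beta1_crit p}. Values of q to the right of
   beta1_crit p are irrelevant. The endpoint of the curve falls under the else branch,
   together with all points off the curve. *)
definition phase_transition_curve :: "nat \<Rightarrow> (real \<Rightarrow> real) \<Rightarrow> bool" where
  "phase_transition_curve p q \<longleftrightarrow>
     q (beta1_crit p) = beta2_crit p \<and>
     (\<forall>\<beta>1 \<beta>2.
        if \<beta>1 < beta1_crit p \<and> \<beta>2 = q \<beta>1
        then \<exists>x1 x2. 0 < x1 \<and> x1 < (real p - 1) / real p \<and> (real p - 1) / real p < x2 \<and> x2 < 1 \<and>
               global_maximizers p \<beta>1 \<beta>2 = {x1, x2}
        else \<exists>x. 0 < x \<and> x < 1 \<and> global_maximizers p \<beta>1 \<beta>2 = {x})"

end

theory Submission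
  imports Defs
begin

text \<open>
  With \<open>p = m + 1\<close> and \<open>t = x\<^sub>1\<^sup>* / x\<^sub>2\<^sup>*\<close>, the two stationarity conditions and the equality of the
  two maximal values can be solved in closed form: \<open>x\<^sub>2\<^sup>* = (1 - t\<^sup>m) / (1 - t\<^bsup>m+1\<^esup>)\<close>, and \<open>\<beta>\<^sub>1\<close> becomes
  an explicit strictly increasing function of \<open>t\<close> on \<open>(0,1)\<close> that tends to \<open>\<beta>\<^sub>1\<^sup>c\<close> as \<open>t \<longrightarrow> 1\<close>.
  Hence \<open>x\<^sub>1\<^sup>*\<close> and \<open>x\<^sub>2\<^sup>*\<close> depend continuously on \<open>\<beta>\<^sub>1\<close>. Comparing the maxima at two points of the curve
  confines the secant slope of \<open>q\<close> between \<open>- (x\<^sub>1 - y\<^sub>2) / (x\<^sub>1\<^sup>p - y\<^sub>2\<^sup>p)\<close> and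
  \<open>- (y\<^sub>1 - x\<^sub>2) / (y\<^sub>1\<^sup>p - x\<^sub>2\<^sup>p)\<close>, where \<open>x\<^sub>1 < x\<^sub>2\<close> and \<open>y\<^sub>1 < y\<^sub>2\<close> are the maximizers at the two points,
  which gives the derivative. Finally \<open>- 1 / q'\<close> is the quotient
  \<open>(1 + \<dots> + t\<^bsup>m-1\<^esup>)\<^sup>m / (1 + \<dots> + t\<^sup>m)\<^bsup>m-1\<^esup>\<close>, whose monotonicity in \<open>t\<close> is convexity of \<open>q\<close> and whose
  values at \<open>0\<close> and \<open>1\<close> are the two limits.
\<close>

section \<open>Geometric sums\<close>

definition geo :: "nat \<Rightarrow> real \<Rightarrow> real" where
  "geo k t = (\<Sum>i<k. t ^ i)"

lemma geo_0 [simp]: "geo 0 t = 0"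
  and geo_Suc: "geo (Suc k) t = geo k t + t ^ k"
  by (simp_all add: geo_def)

lemma one_minus_power_eq_geo: "1 - t ^ k = (1 - t) * geo k t"
  unfolding geo_def by (rule one_diff_power_eq)

lemma geo_shift: "geo (Suc k) t = 1 + t * geo k t"
  unfolding geo_def by (simp add: sum.lessThan_Suc_shift sum_distrib_left del: sum.lessThan_Suc)

lemma geo_ge_one: "k \<ge> 1 \<Longrightarrow> t \<ge> 0 \<Longrightarrow> geo k t \<ge> 1"
  using sum_nonneg[of "{..<k - 1}" "\<lambda>i. t ^ i"]
  by (cases k) (auto simp: geo_shift simp flip: geo_def)

lemma geo_pos: "k \<ge> 1 \<Longrightarrow> t \<ge> 0 \<Longrightarrow> geo k t > 0"
  using geo_ge_one[of k t] by linarith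

lemma geo_at_one [simp]: "geo k 1 = real k"
  by (simp add: geo_def)

lemma geo_at_zero: "k \<ge> 1 \<Longrightarrow> geo k 0 = 1"
  by (cases k) (simp_all add: geo_shift)

lemma continuous_on_geo [continuous_intros]: "continuous_on A (geo k)"
  unfolding geo_def[abs_def] by (intro continuous_intros)

section \<open>Log-concavity and monotonicity of geometric sums\<close>

text \<open>The shift identity \<open>t * a = a + w - 1\<close> makes the defect exactly
  \<open>t ^ k\<close>. This exact value turns the factor between consecutive chord slopes into a
  function of the single quantity \<open>t ^ k / (geo (Suc k) t)\<^sup>2\<close>.\<close>

lemma geo_log_concave: "(geo (Suc k) t)\<^sup>2 = geo (Suc (Suc k)) t * geo k t + t ^ k"
proof (induction k)
  case (Suc k)
  define a w where "a = geo (Suc k) t" and "w = t ^ Suc k"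
  have s: "geo (Suc (Suc k)) t = a + w" "geo (Suc (Suc (Suc k))) t = a + w + t * w"
    by (simp_all add: geo_Suc a_def w_def)
  have "t * a = a + w - 1"
    using geo_shift[of "Suc k" t] s(1) by (simp add: a_def)
  then have "(a + w + t * w) * a + w = a * a + w * a + w * (a + w - 1) + w"
    by (simp add: distrib_right mult.assoc mult.left_commute[of t w])
  also have "\<dots> = (a + w)\<^sup>2"
    by (simp add: power2_eq_square algebra_simps)
  finally show ?case
    unfolding s by (simp add: a_def w_def)
qed (simp add: geo_Suc)

text \<open>The palindromic Laurent polynomial \<open>s\<^bsup>-(k-1)\<^esup> geo k (s\<^sup>2)\<close> decreases on \<open>(0,1]\<close>.\<close>

lemma geo_symmetric_mono:
  assumes "0 < s" "s \<le> t" "t \<le> 1"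
  shows "geo (Suc k) (t\<^sup>2) * s ^ k \<le> geo (Suc k) (s\<^sup>2) * t ^ k"
proof (induction k rule: nat_induct2)
  case 1
  have "0 \<le> (t - s) * (1 - s * t)"
    using assms by (intro mult_nonneg_nonneg) (auto simp: mult_le_one)
  then show ?case
    by (simp add: geo_Suc power2_eq_square algebra_simps)
next
  case (step k)
  define u v where "u = s ^ (k + 2)" and "v = t ^ (k + 2)"
  \<comment> \<open>Removing the first and the last term leaves \<open>x\<close> times a sum two
    terms shorter, hence the induction in steps of two. The outer terms and the inner sum are then
    compared separately.\<close>
  have split: "geo (Suc (k + 2)) x = 1 + x * geo (Suc k) x + x ^ (k + 2)" for x
    using geo_shift[of "Suc k" x] by (simp add: geo_Suc)
  have uv: "0 \<le> u" "u \<le> v" "v \<le> 1"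
    using assms power_mono[of s t "k + 2"] power_le_one[of t "k + 2"] unfolding u_def v_def by auto
  then have "0 \<le> (v - u) * (1 - u * v)"
    by (intro mult_nonneg_nonneg) (auto simp: mult_le_one)
  then have 1: "u * (1 + v\<^sup>2) \<le> v * (1 + u\<^sup>2)"
    by (simp add: power2_eq_square algebra_simps)
  have 2: "(s * t)\<^sup>2 * (geo (Suc k) (t\<^sup>2) * s ^ k) \<le> (s * t)\<^sup>2 * (geo (Suc k) (s\<^sup>2) * t ^ k)"
    using step by (intro mult_left_mono) auto
  have sq: "(t\<^sup>2) ^ (k + 2) = v\<^sup>2" "(s\<^sup>2) ^ (k + 2) = u\<^sup>2"
    unfolding u_def v_def by (simp_all only: power_mult[symmetric] mult.commute)
  have "geo (Suc (k + 2)) (t\<^sup>2) * s ^ (k + 2) =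
      u * (1 + v\<^sup>2) + (s * t)\<^sup>2 * (geo (Suc k) (t\<^sup>2) * s ^ k)"
    unfolding split sq by (simp add: u_def power2_eq_square algebra_simps)
  moreover have "geo (Suc (k + 2)) (s\<^sup>2) * t ^ (k + 2) =
      v * (1 + u\<^sup>2) + (s * t)\<^sup>2 * (geo (Suc k) (s\<^sup>2) * t ^ k)"
    unfolding split sq by (simp add: v_def power2_eq_square algebra_simps)
  ultimately show ?case
    using 1 2 by simp
qed (simp add: geo_Suc)

text \<open>This is \<open>geo_symmetric_mono\<close> at the square roots, squared. Equivalently,
  the relative defect in \<open>geo_log_concave\<close> is nondecreasing on (0,1].\<close>

lemma power_geo_mono:
  assumes "0 < s" "s \<le> t" "t \<le> 1"
  shows "(geo (Suc k) t)\<^sup>2 * s ^ k \<le> (geo (Suc k) s)\<^sup>2 * t ^ k"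
proof -
  have "geo (Suc k) t * sqrt s ^ k \<le> geo (Suc k) s * sqrt t ^ k"
    using geo_symmetric_mono[of "sqrt s" "sqrt t" k] assms by simp
  then have "(geo (Suc k) t * sqrt s ^ k)\<^sup>2 \<le> (geo (Suc k) s * sqrt t ^ k)\<^sup>2"
    using assms geo_pos[of "Suc k" t] by (intro power_mono) auto
  moreover have "(sqrt x ^ k)\<^sup>2 = x ^ k" if "x \<ge> 0" for x
    using that by (metis power_mult mult.commute real_sqrt_pow2)
  ultimately show ?thesis
    using assms by (simp add: power_mult_distrib)
qed

text \<open>AM-GM for the numbers 1, s^2, ..., s^(2k), whose geometric mean is s^k.\<close>

lemma Suc_mult_power_le_geo:
  assumes "0 < s" "s \<le> 1"
  shows "real (Suc k) * s ^ k \<le> geo (Suc k) (s\<^sup>2)"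
  using geo_symmetric_mono[of s 1 k] assms by simp

section \<open>Monotonicity of the chord slope\<close>

text \<open>The slope of the chord of \<open>x \<mapsto> x\<^bsup>m+1\<^esup>\<close> between the two maximizers,
  in terms of their ratio.\<close>

definition chord_slope :: "nat \<Rightarrow> real \<Rightarrow> real" where
  "chord_slope m t = geo m t ^ m / geo (Suc m) t ^ (m - 1)"

lemma chord_slope_pos: "m \<ge> 1 \<Longrightarrow> t \<ge> 0 \<Longrightarrow> chord_slope m t > 0"
  unfolding chord_slope_def by (simp add: geo_pos)

text \<open>By \<open>geo_log_concave\<close> the new factor is a power of \<open>1 / (1 - t\<^sup>m / (geo (m+1) t)\<^sup>2)\<close>, so monotonicity in \<open>t\<close>
  follows by induction on \<open>m\<close>.\<close>

lemma chord_slope_Suc: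
  assumes "m \<ge> 1" "t \<ge> 0"
  shows "chord_slope (Suc m) t =
    chord_slope m t * ((geo (Suc m) t)\<^sup>2 / (geo (Suc (Suc m)) t * geo m t)) ^ m"
proof -
  obtain n where n: "m = Suc n"
    using assms(1) by (cases m) auto
  have pos: "geo m t > 0" "geo (Suc m) t > 0" "geo (Suc (Suc m)) t > 0"
    using assms by (auto intro: geo_pos)
  have "geo (Suc m) t ^ (2 * m) = geo (Suc m) t ^ Suc m * geo (Suc m) t ^ n"
    unfolding power_add[symmetric] n by (simp add: mult_2)
  then have "((geo (Suc m) t)\<^sup>2 / (geo (Suc (Suc m)) t * geo m t)) ^ m =
      geo (Suc m) t ^ Suc m * geo (Suc m) t ^ n / (geo (Suc (Suc m)) t ^ m * geo m t ^ m)"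
    by (simp only: power_divide power_mult_distrib power_mult[symmetric])
  moreover have "m - 1 = n" "Suc m - 1 = m"
    using n by simp_all
  ultimately show ?thesis
    using pos unfolding chord_slope_def by (simp del: power_Suc)
qed

lemma chord_slope_mono:
  assumes "m \<ge> 1" "0 < s" "s \<le> t" "t \<le> 1"
  shows "chord_slope m s \<le> chord_slope m t"
  using assms(1)
proof (induction m rule: dec_induct)
  \<comment> \<open>For \<open>m = 1\<close> the slope is constantly 1.\<close>
  case base
  show ?case
    by (simp add: chord_slope_def geo_Suc)
next
  case (step m)
  have pos: "geo m x > 0" "geo (Suc m) x > 0" "geo (Suc (Suc m)) x > 0" if "x \<ge> 0" for x
    using that step.hyps by (auto intro: geo_pos)
  have ratio: "(geo (Suc m) x)\<^sup>2 / (geo (Suc (Suc m)) x * geo m x) =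
      1 / (1 - x ^ m / (geo (Suc m) x)\<^sup>2)" and
    ratio_pos: "1 - x ^ m / (geo (Suc m) x)\<^sup>2 > 0" if "x \<ge> 0" for x
  proof -
    have "1 - x ^ m / (geo (Suc m) x)\<^sup>2 = geo (Suc (Suc m)) x * geo m x / (geo (Suc m) x)\<^sup>2"
      using geo_log_concave[of m x, symmetric] pos(2)[OF that] by (simp add: diff_divide_eq_iff)
    then show "(geo (Suc m) x)\<^sup>2 / (geo (Suc (Suc m)) x * geo m x) =
      1 / (1 - x ^ m / (geo (Suc m) x)\<^sup>2)" "1 - x ^ m / (geo (Suc m) x)\<^sup>2 > 0"
      using pos[OF that] by simp_all
  qed
  have "s ^ m / (geo (Suc m) s)\<^sup>2 \<le> t ^ m / (geo (Suc m) t)\<^sup>2"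
    using power_geo_mono[OF assms(2-4), of m] pos[of s] pos[of t] assms
    by (simp add: field_simps)
  then have "1 / (1 - s ^ m / (geo (Suc m) s)\<^sup>2) \<le> 1 / (1 - t ^ m / (geo (Suc m) t)\<^sup>2)"
    using ratio_pos[of s] ratio_pos[of t] assms by (intro divide_left_mono mult_pos_pos) auto
  then have "((geo (Suc m) s)\<^sup>2 / (geo (Suc (Suc m)) s * geo m s)) ^ m
      \<le> ((geo (Suc m) t)\<^sup>2 / (geo (Suc (Suc m)) t * geo m t)) ^ m"
    using assms ratio_pos[of s] by (intro power_mono) (simp_all add: ratio)
  then show ?case
    using step chord_slope_pos[of m s] chord_slope_pos[of m t] pos[of s] assms
    by (subst (1 2) chord_slope_Suc) (auto intro!: mult_mono)
qed

text \<open>The domain contains 0 because the ratio of the maximizers tends to 0 as \<beta>1 tends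
  to minus infinity.\<close>

lemma continuous_on_chord_slope: "continuous_on {0..} (chord_slope m)"
proof -
  have "geo (Suc m) t ^ (m - 1) \<noteq> 0" if "t \<in> {0..}" for t
    using geo_pos[of "Suc m" t] that by simp
  then show ?thesis
    unfolding chord_slope_def[abs_def] by (intro continuous_intros) auto
qed

section \<open>The curve parametrized by the ratio of the maximizers\<close>

lemma decreasing_positive:
  fixes f :: "real \<Rightarrow> real"
  assumes "0 < t" "t < 1" "f 1 = 0"
    and der: "\<And>x. 0 < x \<Longrightarrow> (f has_real_derivative f' x) (at x)"
    and neg: "\<And>x. 0 < x \<Longrightarrow> x < 1 \<Longrightarrow> f' x < 0"
  shows "f t > 0"
proof -
  have "f 1 < f t"
  proof (rule DERIV_neg_imp_decreasing_open[OF assms(2)])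
    show "\<exists>y. (f has_real_derivative y) (at x) \<and> y < 0" if "t < x" "x < 1" for x
      using der[of x] neg[of x] that assms(1) by auto
    show "continuous_on {t..1} f"
    proof (rule DERIV_continuous_on)
      show "(f has_real_derivative f' x) (at x within {t..1})" if "x \<in> {t..1}" for x
        using der[of x] that assms(1) by (auto intro: has_field_derivative_at_within)
    qed
  qed
  then show ?thesis
    using assms by simp
qed

text \<open>At \<open>t = sqrt x\<close> this is the inequality between the geometric and the
  logarithmic mean of x and 1.\<close>

lemma neg_ln_less:
  assumes "0 < t" "t < (1::real)"
  shows "- 2 * ln t < 1 / t - t"
proof -
  have "1 / t - t + 2 * ln t > 0"
  proof (rule decreasing_positive[OF assms, where f = "\<lambda>t. 1 / t - t + 2 * ln t"])
    show "((\<lambda>t. 1 / t - t + 2 * ln t) has_real_derivative - ((1 - x) / x)\<^sup>2) (at x)" if "0 < x" for x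
      using that by (auto intro!: derivative_eq_intros simp: field_simps power2_eq_square)
  qed auto
  then show ?thesis
    by simp
qed

text \<open>The inequality between the logarithmic and the arithmetic mean of t and 1.\<close>

lemma neg_ln_greater:
  assumes "0 < t" "t < (1::real)"
  shows "1 - t < (1 + t) / 2 * (- ln t)"
proof -
  have "- ln t - 2 * (1 - t) / (1 + t) > 0"
  proof (rule decreasing_positive[OF assms, where f = "\<lambda>t. - ln t - 2 * (1 - t) / (1 + t)"])
    show "((\<lambda>t. - ln t - 2 * (1 - t) / (1 + t)) has_real_derivative
        - ((1 - x)\<^sup>2 / (x * (1 + x)\<^sup>2))) (at x)" if "0 < x" for x
    proof -
      have "- (1 / x) - ((- 2) * (1 + x) - 2 * (1 - x)) / (1 + x)\<^sup>2 = - ((1 - x)\<^sup>2 / (x * (1 + x)\<^sup>2))"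
        using that by (simp add: divide_simps) (simp add: power2_eq_square algebra_simps)
      then show ?thesis
        using that by (auto intro!: derivative_eq_intros simp: power2_eq_square)
    qed
  qed auto
  then show ?thesis
    using assms by (simp add: field_simps)
qed


section \<open>Bounds for quotients of geometric sums\<close>

lemma geo_le: "0 \<le> t \<Longrightarrow> t \<le> 1 \<Longrightarrow> geo k t \<le> real k"
  unfolding geo_def using sum_bounded_above[of "{..<k}" "\<lambda>i. t ^ i" 1] by (simp add: power_le_one)

lemma geo_greater:
  assumes "m \<ge> 1" "0 < t" "t < 1"
  shows "real m * t ^ m < geo m t"
proof -
  have "(\<Sum>i<m. t ^ m) < (\<Sum>i<m. t ^ i)"
    using assms by (intro sum_strict_mono) (auto simp: power_strict_decreasing lessThan_empty_iff)
  then show ?thesis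
    by (simp add: geo_def)
qed

text \<open>Yields \<open>(1 + t) / 2 \<le> \<sigma>\<close> for the \<sigma> of
  \<open>ratio_equation_solution\<close>. In the induction, t times the hypothesis leaves the
  remainder \<open>(1 - t) * (m - t * geo m t)\<close>, which is nonnegative.\<close>

lemma geo_ratio_lower:
  assumes "m \<ge> 1" "0 < t" "t < 1"
  shows "real (Suc m) * (1 + t) * geo m t \<le> 2 * real m * geo (Suc m) t"
  using assms(1)
proof (induction m rule: dec_induct)
  case base
  show ?case
    by (simp add: geo_Suc)
next
  case (step m)
  have "t * ((1 - t) * geo m t) \<le> 1 * ((1 - t) * real m)"
    using assms geo_le[of t m] geo_pos[of m t] step.hyps
    by (intro mult_mono mult_left_mono) auto
  moreover have "t * (real (Suc m) * (1 + t) * geo m t) \<le> t * (2 * real m * geo (Suc m) t)"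
    using step.IH assms by (intro mult_left_mono) auto
  moreover have "geo (Suc (Suc m)) t = 1 + t + t * (t * geo m t)" "geo (Suc m) t = 1 + t * geo m t"
    by (simp_all add: geo_shift distrib_left)
  ultimately show ?case
    by (simp add: algebra_simps)
qed

section \<open>The larger maximizer for a given ratio\<close>

text \<open>For a fixed ratio \<open>t\<close> of the two maximizers, eliminating both parameters from the two
  stationarity conditions and the equality of values leaves one equation for the larger maximizer
  \<open>b\<close>. By Rolle it has at most one solution in \<open>(0,1)\<close>, since after differentiation it becomes
  quadratic.\<close>

lemma quadratic_unique_root:
  fixes A B C :: real
  assumes "C < 0" "A + B + C > 0" "0 < z" "z < w" "w < 1"
    and "A * z\<^sup>2 + B * z + C = 0" "A * w\<^sup>2 + B * w + C = 0"
  shows False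
proof -
  have "(w - z) * (A * (w + z) + B) = (A * w\<^sup>2 + B * w + C) - (A * z\<^sup>2 + B * z + C)"
    by (simp add: power2_eq_square algebra_simps)
  \<comment> \<open>Vieta's relations. The negative value at 0 forces \<open>A < 0\<close>, the
    positive value at 1 forces \<open>A > 0\<close>.\<close>
  then have B: "B = - A * (w + z)"
    using assms by simp
  have "C = A * z * w"
    using assms(6) unfolding B by (simp add: power2_eq_square algebra_simps)
  then have "A < 0"
    using assms by (simp add: mult_less_0_iff mult.assoc)
  moreover have "A + B + C = A * ((1 - z) * (1 - w))"
    unfolding B \<open>C = A * z * w\<close> by (simp add: algebra_simps)
  moreover have "(1 - z) * (1 - w) > 0"
    using assms by simp
  ultimately show False
    using assms mult_neg_pos[of A "(1 - z) * (1 - w)"] by linarith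
qed

text \<open>The two conditions on \<sigma> fix the signs of the quadratic at the ends of the
  interval: negative at 0, positive at 1.\<close>

lemma ratio_equation_unique:
  fixes t \<sigma> :: real
  defines "J \<equiv> \<lambda>b. ln (1 - b * t) - ln (1 - b) + ln t * (b * \<sigma>) / (1 - b * \<sigma>)"
  assumes t: "0 < t" "t < 1" and \<sigma>: "\<sigma> < 1" "1 - t < \<sigma> * (- ln t)"
    and b: "0 < b" "b < 1" "J b = 0" and c: "0 < c" "c < 1" "J c = 0"
  shows "b = c"
proof -
  have False if bc: "0 < b" "b < c" "c < 1" "J b = 0" "J c = 0" for b c
  proof -
    define J' where "J' x = - t / (1 - x * t) + 1 / (1 - x) + ln t * \<sigma> / (1 - x * \<sigma>)\<^sup>2" for x
    have \<sigma>0: "\<sigma> > 0"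
      using \<sigma>(2) t by (smt (verit) ln_less_zero mult_nonneg_nonneg mult_nonpos_nonneg)
    have pos: "1 - x * t > 0" "1 - x > 0" "1 - x * \<sigma> > 0" if "x \<in> {0..c}" for x
    proof -
      have "x * t \<le> x" "x * \<sigma> \<le> x"
        using that t \<sigma> \<sigma>0 by (auto intro: mult_right_le_one_le)
      then show "1 - x * t > 0" "1 - x > 0" "1 - x * \<sigma> > 0"
        using that bc by auto
    qed
    have der: "(J has_real_derivative J' x) (at x)" if "x \<in> {0..c}" for x
    proof -
      have "(ln t * \<sigma> * (1 - x * \<sigma>) + ln t * (x * \<sigma>) * \<sigma>) / (1 - x * \<sigma>)\<^sup>2 = ln t * \<sigma> / (1 - x * \<sigma>)\<^sup>2"
        by (simp add: algebra_simps)
      then show ?thesis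
        using pos[OF that] unfolding J_def J'_def
        by (auto intro!: derivative_eq_intros simp: power2_eq_square mult.commute[of \<sigma>])
    qed
    have cont: "continuous_on {0..c} J"
      using der by (intro DERIV_continuous_on) (blast intro: has_field_derivative_at_within)
    \<comment> \<open>With 0 as a third zero next to \<open>b\<close> and \<open>c\<close>, Rolle
      gives two critical points \<open>z < b < w\<close>.\<close>
    have "J 0 = 0"
      by (simp add: J_def)
    have diff: "J differentiable (at x)" if "x \<in> {0..c}" for x
      using der[OF that] by (auto simp: real_differentiable_def)
    have "\<exists>z. 0 < z \<and> z < b \<and> (J has_real_derivative 0) (at z)"
      by (rule Rolle) (use bc \<open>J 0 = 0\<close> in \<open>auto intro: continuous_on_subset[OF cont] diff\<close>)
    then obtain z where z: "0 < z" "z < b" "(J has_real_derivative 0) (at z)"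
      by blast
    have "\<exists>w. b < w \<and> w < c \<and> (J has_real_derivative 0) (at w)"
      by (rule Rolle) (use bc in \<open>auto intro: continuous_on_subset[OF cont] diff\<close>)
    then obtain w where w: "b < w" "w < c" "(J has_real_derivative 0) (at w)"
      by blast
    have quad: "((1 - t) * \<sigma>\<^sup>2 + ln t * \<sigma> * t) * x\<^sup>2 + (- 2 * (1 - t) * \<sigma> - ln t * \<sigma> * (1 + t)) * x
        + ((1 - t) + ln t * \<sigma>) = 0" if "x \<in> {0..c}" "(J has_real_derivative 0) (at x)" for x
    proof -
      have "J' x = 0"
        using DERIV_unique[OF der that(2)] that(1) .
      \<comment> \<open>The first two terms on the right combine to
        \<open>(1 - t) * (1 - x * \<sigma>)\<^sup>2\<close>, so the numerator of \<open>J'\<close>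
        is only quadratic.\<close>
      have "(1 - x * t) * (1 - x) * (1 - x * \<sigma>)\<^sup>2 * J' x =
          - t * (1 - x) * (1 - x * \<sigma>)\<^sup>2 + (1 - x * t) * (1 - x * \<sigma>)\<^sup>2
          + ln t * \<sigma> * ((1 - x * t) * (1 - x))"
        using pos[OF that(1)] unfolding J'_def by (simp add: divide_simps) (simp add: algebra_simps)
      then show ?thesis
        using \<open>J' x = 0\<close> by (simp add: power2_eq_square algebra_simps)
    qed
    show False
    proof (rule quadratic_unique_root)
      show "(1 - t) + ln t * \<sigma> < 0"
        using \<sigma> by (simp add: mult.commute)
      \<comment> \<open>This is the value of the quadratic at 1, where the terms with
        \<open>ln t\<close> cancel.\<close>
      have "(1 - t) * (1 - \<sigma>)\<^sup>2 > 0"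
        using t \<sigma> by simp
      then show "((1 - t) * \<sigma>\<^sup>2 + ln t * \<sigma> * t) + (- 2 * (1 - t) * \<sigma> - ln t * \<sigma> * (1 + t))
        + ((1 - t) + ln t * \<sigma>) > 0"
        by (simp add: power2_eq_square algebra_simps)
      show "((1 - t) * \<sigma>\<^sup>2 + ln t * \<sigma> * t) * z\<^sup>2 + (- 2 * (1 - t) * \<sigma> - ln t * \<sigma> * (1 + t)) * z
        + ((1 - t) + ln t * \<sigma>) = 0"
        by (rule quad[OF _ z(3)]) (use z w in auto)
      show "((1 - t) * \<sigma>\<^sup>2 + ln t * \<sigma> * t) * w\<^sup>2 + (- 2 * (1 - t) * \<sigma> - ln t * \<sigma> * (1 + t)) * w
        + ((1 - t) + ln t * \<sigma>) = 0"
        by (rule quad[OF _ w(3)]) (use z w bc in auto)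
    qed (use z w bc in auto)
  qed
  then show ?thesis
    using b c by (metis linorder_neqE_linordered_idom)
qed

text \<open>The stated quotient \<open>c\<close> solves the equation, since
  \<open>c * \<sigma> = m / (m + 1)\<close> makes both sides equal to \<open>- m * ln t\<close>;
  uniqueness does the rest.\<close>

lemma ratio_equation_solution:
  assumes m: "m \<ge> 1" and t: "0 < t" "t < 1"
    and b: "0 < b" "b < 1"
    and "ln (1 - b * t) - ln (1 - b) = - ln t * (b * \<sigma>) / (1 - b * \<sigma>)"
    and \<sigma>_def: "\<sigma> = real m * geo (Suc m) t / (real (Suc m) * geo m t)"
  shows "b = geo m t / geo (Suc m) t"
proof -
  define c where "c = geo m t / geo (Suc m) t"
  have pos: "geo m t > 0" "geo (Suc m) t > 0"
    using m t by (auto intro: geo_pos)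
  have c1: "1 - c * t = 1 / geo (Suc m) t" "1 - c = t ^ m / geo (Suc m) t"
    using pos geo_shift[of m t] geo_Suc[of m t] by (simp_all add: c_def field_simps)
  have "1 - c > 0"
    unfolding c1 using pos t by simp
  have c\<sigma>: "c * \<sigma> = real m / real (Suc m)"
    using pos by (simp add: c_def \<sigma>_def)
  show ?thesis
    unfolding c_def[symmetric]
  proof (rule ratio_equation_unique[OF t _ _ b])
    have "real m * geo (Suc m) t < real (Suc m) * geo m t"
      using geo_greater[OF m t] by (simp add: geo_Suc algebra_simps)
    then show "\<sigma> < 1"
      using pos by (simp add: \<sigma>_def)
    have "(1 + t) / 2 \<le> \<sigma>"
      using geo_ratio_lower[OF m t] pos
      by (simp add: \<sigma>_def divide_le_eq le_divide_eq mult.commute mult.left_commute del: of_nat_Suc)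
    then have "(1 + t) / 2 * (- ln t) \<le> \<sigma> * (- ln t)"
      using t by (intro mult_right_mono) auto
    then show "1 - t < \<sigma> * (- ln t)"
      using neg_ln_greater[OF t] by simp
    show "ln (1 - b * t) - ln (1 - b) + ln t * (b * \<sigma>) / (1 - b * \<sigma>) = 0"
      using assms by simp
    show "0 < c" "c < 1"
      using pos \<open>1 - c > 0\<close> by (simp_all add: c_def)
    have "ln (1 - c * t) - ln (1 - c) = - (real m * ln t)"
      unfolding c1 using pos t by (simp add: ln_div ln_realpow)
    moreover have "ln t * (c * \<sigma>) / (1 - c * \<sigma>) = real m * ln t"
      unfolding c\<sigma> by (simp add: field_simps)
    ultimately show "ln (1 - c * t) - ln (1 - c) + ln t * (c * \<sigma>) / (1 - c * \<sigma>) = 0"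
      by simp
  qed
qed

section \<open>The parameter \<beta>1 as a function of the ratio\<close>

text \<open>Stationarity at the smaller maximizer \<open>a\<close>, solved for \<beta>1: there
  \<open>ln a - ln (1 - a)\<close> equals \<open>ln t + ln (geo m t)\<close> and
  \<open>\<beta>2 * a ^ m\<close> equals \<open>- t ^ m * ln t / (1 - t ^ m)\<close>.\<close>

definition beta1_of_ratio :: "nat \<Rightarrow> real \<Rightarrow> real" where
  "beta1_of_ratio m t = ln t + ln (geo m t) + real (Suc m) * (t ^ m * ln t / (1 - t ^ m))"

text \<open>Equality of values and the difference of the stationarity conditions express
  \<open>L\<close> and \<open>L - ln t\<close> as multiples of \<open>K\<close>. Eliminating
  \<open>K\<close> leaves the equation of \<open>ratio_equation_solution\<close>.\<close>

lemma stationary_pair_by_ratio: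
  fixes a b \<beta>1 \<beta>2 :: real
  defines "t \<equiv> a / b"
  assumes m: "m \<ge> 1" and ab: "0 < a" "a < b" "b < 1"
    and sa: "\<beta>1 + \<beta>2 * (real (Suc m) * a ^ m) = ln a - ln (1 - a)"
    and sb: "\<beta>1 + \<beta>2 * (real (Suc m) * b ^ m) = ln b - ln (1 - b)"
    and eq: "ell (Suc m) \<beta>1 \<beta>2 a = ell (Suc m) \<beta>1 \<beta>2 b"
  shows "b = geo m t / geo (Suc m) t" and "\<beta>1 = beta1_of_ratio m t"
proof -
  have t: "0 < t" "t < 1" and a: "a = t * b"
    using ab by (simp_all add: t_def)
  have pos: "geo m t > 0" "geo (Suc m) t > 0"
    using m t by (auto intro: geo_pos)
  have ell_eq: "ell (Suc m) \<beta>1 \<beta>2 x = - (real m * \<beta>2 * x ^ Suc m) - ln (1 - x)"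
    if "\<beta>1 + \<beta>2 * (real (Suc m) * x ^ m) = ln x - ln (1 - x)" for x
  proof -
    have "\<beta>1 = ln x - ln (1 - x) - \<beta>2 * (real (Suc m) * x ^ m)"
      using that by simp
    then show ?thesis
      unfolding ell_def by (simp only:) (simp add: algebra_simps)
  qed
  define L where "L = ln (1 - a) - ln (1 - b)"
  define K where "K = \<beta>2 * b ^ m"
  \<comment> \<open>Chosen so that dividing \<open>L1\<close> by \<open>L2\<close> gives
    \<open>L = b * \<sigma> * (L - ln t)\<close>.\<close>
  define \<sigma> where "\<sigma> = real m * geo (Suc m) t / (real (Suc m) * geo m t)"
  have L1: "L = real m * (K * (b * (1 - t ^ Suc m)))"
    using eq ell_eq[OF sa] ell_eq[OF sb] by (simp add: L_def K_def a power_mult_distrib algebra_simps)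
  have L2: "L - ln t = real (Suc m) * (K * (1 - t ^ m))"
    using sa sb t ab by (simp add: L_def K_def a power_mult_distrib ln_mult algebra_simps)
  have "\<sigma> * (real (Suc m) * geo m t) = real m * geo (Suc m) t"
    using pos by (simp add: \<sigma>_def)
  then have "(b * K * (1 - t)) * (\<sigma> * (real (Suc m) * geo m t)) = (b * K * (1 - t)) * (real m * geo (Suc m) t)"
    by simp
  then have "b * \<sigma> * (L - ln t) = L"
    unfolding L2 unfolding L1 one_minus_power_eq_geo by (simp only: mult_ac)
  then have L3: "L * (1 - b * \<sigma>) = - ln t * (b * \<sigma>)"
    by (simp add: algebra_simps)
  moreover have "1 - b * \<sigma> \<noteq> 0"
  proof
    assume "1 - b * \<sigma> = 0"
    then have "b * \<sigma> = 1" "ln t * (b * \<sigma>) = 0"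
      using L3 by simp_all
    then show False
      using t by simp
  qed
  ultimately have "L = - ln t * (b * \<sigma>) / (1 - b * \<sigma>)"
    by (simp add: field_simps)
  then show b: "b = geo m t / geo (Suc m) t"
    using ratio_equation_solution[OF m t _ _ _ \<sigma>_def, of b] ab by (simp add: L_def a mult.commute)
  have "b * \<sigma> = real m / real (Suc m)"
    using pos by (simp add: b \<sigma>_def)
  then have "L = - (real m * ln t)"
  proof -
    have "L * (1 / real (Suc m)) = - ln t * real m / real (Suc m)"
      using L3 unfolding \<open>b * \<sigma> = real m / real (Suc m)\<close> by (simp add: field_simps)
    then show ?thesis
      by (simp add: divide_simps mult.commute del: of_nat_Suc)
  qed
  then have "real (Suc m) * (K * (1 - t ^ m)) = real (Suc m) * (- ln t)"
    unfolding L2[symmetric] by (simp add: algebra_simps)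
  then have "K * (1 - t ^ m) = - ln t"
    by (simp only: mult_cancel_left) simp
  moreover have "1 - t ^ m > 0"
    using t m by (simp add: power_less_one_iff)
  ultimately have K: "K = - ln t / (1 - t ^ m)"
    by (simp add: field_simps)
  have "1 - a = 1 / geo (Suc m) t" "a = t * geo m t / geo (Suc m) t"
    using pos geo_shift[of m t] by (simp_all add: a b field_simps)
  then have "ln a - ln (1 - a) = ln t + ln (geo m t)"
    using pos t by (simp add: ln_div ln_mult)
  moreover have "\<beta>1 = ln a - ln (1 - a) - real (Suc m) * (K * t ^ m)"
    using sa by (simp add: K_def a power_mult_distrib algebra_simps)
  ultimately show "\<beta>1 = beta1_of_ratio m t"
    unfolding K beta1_of_ratio_def by simp
qed

text \<open>Up to a positive factor the derivative is
  \<open>geo (m + 1) x * (1 - u) + (m + 1) * m * u * ln x\<close> with \<open>u = x ^ m\<close>. It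
  is positive by \<open>neg_ln_less\<close> at \<open>w = sqrt u\<close> and the AM-GM bound for
  \<open>geo (m + 1) x\<close>.\<close>

lemma beta1_of_ratio_strict_mono:
  assumes m: "m \<ge> 1" and "0 < s" "s < t" "t < 1"
  shows "beta1_of_ratio m s < beta1_of_ratio m t"
proof (rule DERIV_pos_imp_increasing[OF \<open>s < t\<close>])
  fix x assume "s \<le> x" "x \<le> t"
  then have x: "0 < x" "x < 1"
    using assms by auto
  define u w where "u = x ^ m" and "w = sqrt x ^ m"
  define D where "D = 1 / x - real m * (u / x) / (1 - u) + 1 / (1 - x)
    + real (Suc m) * ((u / x) * (1 - u) + real m * (u / x) * ln x) / (1 - u)\<^sup>2"
  have u: "0 < u" "u < 1"
    using x m by (simp_all add: u_def power_less_one_iff)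
  have um: "x ^ (m - Suc 0) = u / x"
    using x m by (simp add: u_def power_diff)
  \<comment> \<open>Here \<open>ln (geo m x)\<close> is replaced by
    \<open>ln (1 - x ^ m) - ln (1 - x)\<close>, which is easier to differentiate and agrees with it
    on (0,1).\<close>
  have "((\<lambda>x. ln x + ln (1 - x ^ m) - ln (1 - x) + real (Suc m) * (x ^ m * ln x / (1 - x ^ m)))
      has_real_derivative D) (at x)"
  proof -
    have d1: "((\<lambda>x. x ^ m * ln x) has_real_derivative real m * (u / x) * ln x + u / x) (at x)"
      using x by (auto intro!: derivative_eq_intros simp: um simp flip: u_def)
    have d2: "((\<lambda>x. 1 - x ^ m) has_real_derivative - (real m * (u / x))) (at x)"
      using x by (auto intro!: derivative_eq_intros simp: um)
    have d3: "((\<lambda>x. ln (1 - x ^ m)) has_real_derivative - (real m * (u / x)) / (1 - u)) (at x)"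
      using DERIV_chain2[OF DERIV_ln_divide d2] u by (simp add: u_def mult.commute)
    have d4: "((\<lambda>x. ln (1 - x)) has_real_derivative - 1 / (1 - x)) (at x)"
      using x by (auto intro!: derivative_eq_intros)
    have d5: "((\<lambda>x. x ^ m * ln x / (1 - x ^ m)) has_real_derivative
        ((real m * (u / x) * ln x + u / x) * (1 - u) - (u * ln x) * - (real m * (u / x))) / ((1 - u) * (1 - u))) (at x)"
      using DERIV_divide[OF d1 d2] u by (simp add: u_def)
    have N: "(real m * (u / x) * ln x + u / x) * (1 - u) - (u * ln x) * - (real m * (u / x)) =
        (u / x) * (1 - u) + real m * (u / x) * ln x"
      using x by (simp add: field_simps)
    note d = DERIV_add[OF DERIV_diff[OF DERIV_add[OF DERIV_ln_divide[OF x(1)] d3] d4] DERIV_cmult[OF d5[unfolded N], of "real (Suc m)"]]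
    show ?thesis
      by (rule DERIV_cong[OF d]) (simp add: D_def power2_eq_square del: of_nat_Suc)
  qed
  moreover have "eventually (\<lambda>x. x \<in> {0<..<1}) (nhds x)"
    using x by (intro eventually_nhds_in_open) auto
  then have "eventually (\<lambda>x. ln x + ln (1 - x ^ m) - ln (1 - x) + real (Suc m) * (x ^ m * ln x / (1 - x ^ m)) =
      beta1_of_ratio m x) (nhds x)"
  proof eventually_elim
    case (elim x)
    then have "ln (1 - x ^ m) = ln (1 - x) + ln (geo m x)"
      unfolding one_minus_power_eq_geo using geo_pos[of m x] m by (subst ln_mult) auto
    then show ?case
      by (simp add: beta1_of_ratio_def)
  qed
  ultimately have "(beta1_of_ratio m has_real_derivative D) (at x)"
    by (simp cong: DERIV_cong_ev)
  moreover have "D > 0"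
  proof -
    have w: "0 < w" "w < 1" "u = w\<^sup>2"
      using x m power_less_one_iff[of "sqrt x" m]
      by (simp_all add: w_def u_def power_mult[symmetric] mult.commute[of m] power_mult)
    have "2 * ln w = real m * ln x"
      using x by (simp add: w_def ln_realpow ln_sqrt)
    then have "- real m * ln x < (1 - u) / w"
      using neg_ln_less[OF w(1,2)] w by (simp add: power2_eq_square diff_divide_distrib)
    then have "u * (- real m * ln x) < u * ((1 - u) / w)"
      using u by (intro mult_strict_left_mono)
    then have "u * (- real m * ln x) < w * (1 - u)"
      using w by (simp add: power2_eq_square)
    then have "real (Suc m) * (u * (- real m * ln x)) < real (Suc m) * (w * (1 - u))"
      by (intro mult_strict_left_mono) auto
    also have "\<dots> = real (Suc m) * w * (1 - u)"
      by simp
    also have "\<dots> \<le> geo (Suc m) x * (1 - u)"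
      using Suc_mult_power_le_geo[of "sqrt x" m] x u by (intro mult_right_mono) (auto simp: w_def)
    finally have N: "geo (Suc m) x * (1 - u) + real (Suc m) * (u * real m * ln x) > 0"
      by simp
    have gm: "1 - u = (1 - x) * geo m x" and gs: "geo (Suc m) x = geo m x + u"
      by (simp_all add: u_def one_minus_power_eq_geo geo_Suc)
    have clear: "x * v\<^sup>2 * (1 / x - M * (u / x) / v + y + S * ((u / x) * v + M * (u / x) * l) / v\<^sup>2) =
        v\<^sup>2 - M * u * v + x * v\<^sup>2 * y + S * (u * v + M * u * l)" if "v \<noteq> 0" for v y l M S
      using x that by (simp add: field_simps power2_eq_square)
    have "x * (1 - u)\<^sup>2 * D = (1 - u)\<^sup>2 - real m * u * (1 - u) + x * (1 - u)\<^sup>2 / (1 - x)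
        + real (Suc m) * (u * (1 - u) + real m * u * ln x)"
      unfolding D_def using clear[of "1 - u" "real m" "1 / (1 - x)" "real (Suc m)" "ln x"] u by simp
    also have "x * (1 - u)\<^sup>2 / (1 - x) = (1 - u) * (geo m x - (1 - u))"
      using x by (simp add: gm power2_eq_square field_simps)
    finally have "x * (1 - u)\<^sup>2 * D = geo (Suc m) x * (1 - u) + real (Suc m) * (u * real m * ln x)"
      unfolding gs by (simp add: power2_eq_square algebra_simps)
    then have "x * (1 - u)\<^sup>2 * D > 0"
      using N by simp
    moreover have "x * (1 - u)\<^sup>2 > 0"
      using x u by simp
    ultimately show ?thesis
      by (simp only: zero_less_mult_pos)
  qed
  ultimately show "\<exists>y. (beta1_of_ratio m has_real_derivative y) (at x) \<and> y > 0"
    by blast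
qed

lemma isCont_beta1_of_ratio:
  assumes "m \<ge> 1" "0 < t" "t < 1"
  shows "isCont (beta1_of_ratio m) t"
proof -
  have "1 - t ^ m \<noteq> 0"
    using assms power_less_one_iff[of t m] by auto
  moreover have "isCont (geo m) t"
    using continuous_on_geo[of UNIV m] by (simp add: continuous_on_eq_continuous_at)
  ultimately show ?thesis
    using assms geo_pos[of m t] unfolding beta1_of_ratio_def[abs_def] by (intro continuous_intros) auto
qed

text \<open>Factoring \<open>1 - t ^ m\<close> as \<open>(1 - t) * geo m t\<close> turns the
  singular quotient into the difference quotient of \<open>ln\<close> at 1.\<close>

lemma beta1_of_ratio_tendsto_crit:
  assumes m: "m \<ge> 1"
  shows "(beta1_of_ratio m \<longlongrightarrow> beta1_crit (Suc m)) (at_left 1)"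
proof -
  have "((\<lambda>t. (ln t - ln 1) / (t - 1)) \<longlongrightarrow> 1) (at_left (1::real))"
    using DERIV_ln[of "1::real"] unfolding has_field_derivative_iff
    by (auto intro: tendsto_within_subset)
  moreover have geo: "(geo m \<longlongrightarrow> real m) (at_left 1)"
    using continuous_on_geo[of UNIV m]
    by (metis continuous_on_eq_continuous_at continuous_at_imp_continuous_at_within
        continuous_within geo_at_one open_UNIV UNIV_I)
  ultimately have lim: "((\<lambda>t. ln t + ln (geo m t)
      - real (Suc m) * (t ^ m * ((ln t - ln 1) / (t - 1))) / geo m t) \<longlongrightarrow>
      ln 1 + ln (real m) - real (Suc m) * (1 ^ m * 1) / real m) (at_left 1)"
    using m by (intro tendsto_intros geo) auto
  have crit: "ln 1 + ln (real m) - real (Suc m) * (1 ^ m * 1) / real m = beta1_crit (Suc m)"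
    by (simp add: beta1_crit_def)
  have "eventually (\<lambda>t::real. t < 1) (at_left 1)"
    by (simp add: eventually_at_filter)
  then have "eventually (\<lambda>t. ln t + ln (geo m t)
      - real (Suc m) * (t ^ m * ((ln t - ln 1) / (t - 1))) / geo m t = beta1_of_ratio m t) (at_left 1)"
  proof eventually_elim
    case (elim t)
    have "(ln t - ln 1) / (t - 1) = - (ln t / (1 - t))"
      using elim by (simp add: field_simps)
    then show ?case
      unfolding beta1_of_ratio_def one_minus_power_eq_geo by (simp add: field_simps)
  qed
  then show ?thesis
    using lim unfolding crit by (rule Lim_transform_eventually[rotated])
qed

lemma beta1_of_ratio_less_crit:
  assumes m: "m \<ge> 1" and t: "0 < t" "t < 1"
  shows "beta1_of_ratio m t < beta1_crit (Suc m)"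
proof -
  \<comment> \<open>An intermediate point keeps the inequality strict after passage to the
    limit.\<close>
  define s where "s = (t + 1) / 2"
  have s: "t < s" "s < 1"
    using t by (simp_all add: s_def)
  have "eventually (\<lambda>x. x \<in> {s<..<1}) (at_left 1)"
    using s by (intro eventually_at_left_real)
  then have "eventually (\<lambda>x. beta1_of_ratio m s \<le> beta1_of_ratio m x) (at_left 1)"
    by eventually_elim (use beta1_of_ratio_strict_mono[OF m, of s] s t in force)
  then have "beta1_of_ratio m s \<le> beta1_crit (Suc m)"
    by (intro tendsto_lowerbound[OF beta1_of_ratio_tendsto_crit[OF m]]) auto
  then show ?thesis
    using beta1_of_ratio_strict_mono[OF m, of t s] s t by simp
qed

text \<open>Since \<open>t ^ m * (- ln t) \<le> 1 - t ^ m\<close>, the last summand is at least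
  \<open>- (m + 1)\<close>. The bound forces the ratio to 0 as \<beta>1 tends to minus
  infinity.\<close>

lemma beta1_of_ratio_lower:
  assumes m: "m \<ge> 1" and t: "0 < t" "t < 1"
  shows "ln t - real (Suc m) \<le> beta1_of_ratio m t"
proof -
  obtain n where n: "m = Suc n"
    using m by (cases m) auto
  have u: "t ^ m < 1" "t ^ m \<le> t" "t ^ n \<le> 1"
    using t m power_less_one_iff[of t m] power_decreasing[of 1 m t] by (auto intro: power_le_one)
  have "- ln t \<le> 1 / t - 1"
    using ln_le_minus_one[of "1 / t"] t by (simp add: ln_div)
  then have "t ^ m * (- ln t) \<le> t ^ m * (1 / t - 1)"
    using t by (intro mult_left_mono) auto
  also have "\<dots> = t ^ n * (1 - t)"
    using t by (simp add: n field_simps)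
  also have "\<dots> \<le> 1 * (1 - t)"
    using u t by (intro mult_right_mono) auto
  also have "\<dots> \<le> 1 - t ^ m"
    using u by simp
  finally have "t ^ m * (- ln t) / (1 - t ^ m) \<le> 1"
    using u by (simp only: divide_le_eq_1_pos diff_gt_0_iff_gt)
  then have "real (Suc m) * (t ^ m * (- ln t) / (1 - t ^ m)) \<le> real (Suc m) * 1"
    by (intro mult_left_mono) auto
  moreover have "ln (geo m t) \<ge> 0"
    using geo_ge_one[of m t] m t by simp
  ultimately show ?thesis
    by (simp add: beta1_of_ratio_def)
qed


section \<open>Maximizers along the curve\<close>

lemma stationary_of_maximizer:
  assumes "x \<in> global_maximizers (Suc m) \<beta>1 \<beta>2" "0 < x" "x < 1"
  shows "\<beta>1 + \<beta>2 * (real (Suc m) * x ^ m) = ln x - ln (1 - x)"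
proof -
  have max: "ell (Suc m) \<beta>1 \<beta>2 y \<le> ell (Suc m) \<beta>1 \<beta>2 x" if "y \<in> {0..1}" for y
    using assms(1) that by (force simp: global_maximizers_def is_arg_max_def not_less)
  have "(ell (Suc m) \<beta>1 \<beta>2 has_real_derivative
      \<beta>1 + \<beta>2 * (real (Suc m) * x ^ m) - (ln x - ln (1 - x))) (at x)"
  proof -
    have "((\<lambda>x. x ^ Suc m) has_real_derivative real (Suc m) * x ^ m) (at x)"
      using DERIV_pow[of "Suc m" x] by simp
    moreover have "((\<lambda>x. x * ln x) has_real_derivative ln x + 1) (at x)"
      using assms by (auto intro!: derivative_eq_intros)
    moreover have "((\<lambda>x. (1 - x) * ln (1 - x)) has_real_derivative - ln (1 - x) - 1) (at x)"
      using assms by (auto intro!: derivative_eq_intros)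
    ultimately have D: "((\<lambda>x. \<beta>1 * x + \<beta>2 * x ^ Suc m - x * ln x - (1 - x) * ln (1 - x)) has_real_derivative
        \<beta>1 * 1 + \<beta>2 * (real (Suc m) * x ^ m) - (ln x + 1) - (- ln (1 - x) - 1)) (at x)"
      by (intro DERIV_diff DERIV_add DERIV_cmult DERIV_ident)
    show ?thesis
      unfolding ell_def[abs_def] by (rule DERIV_cong[OF D]) simp
  qed
  then have "\<beta>1 + \<beta>2 * (real (Suc m) * x ^ m) - (ln x - ln (1 - x)) = 0"
    by (rule DERIV_local_max[where d = "min x (1 - x)"]) (use assms max in \<open>auto simp: abs_if split: if_splits\<close>)
  then show ?thesis
    by simp
qed

section \<open>Secant slopes of the curve\<close>

text \<open>Adding the optimality of \<open>x\<close> against \<open>y\<close> and of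
  \<open>y\<close> against \<open>x\<close> cancels the entropy terms.\<close>

lemma maximizer_comparison:
  assumes "x \<in> global_maximizers p b b'" "y \<in> global_maximizers p c c'"
  shows "(c - b) * x + (c' - b') * x ^ p \<le> (c - b) * y + (c' - b') * y ^ p"
proof -
  have "ell p b b' y \<le> ell p b b' x" "ell p c c' x \<le> ell p c c' y"
    using assms by (auto simp: global_maximizers_def is_arg_max_def not_less)
  then show ?thesis
    by (simp add: ell_def algebra_simps)
qed

definition inverse_chord_slope :: "nat \<Rightarrow> real \<Rightarrow> real \<Rightarrow> real" where
  "inverse_chord_slope p x y = (x - y) / (x ^ p - y ^ p)"

text \<open>Comparing crosswise, \<open>x1\<close> with \<open>y2\<close> and \<open>x2\<close> with
  \<open>y1\<close>, gives pairs of known order, so the differences of powers have a known sign when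
  dividing.\<close>

lemma secant_bounds:
  assumes "p > 0" "b < c" "0 \<le> x1" "x1 < y2" "0 \<le> y1" "y1 < x2"
    and "x1 \<in> global_maximizers p b b'" "x2 \<in> global_maximizers p b b'"
    and "y1 \<in> global_maximizers p c c'" "y2 \<in> global_maximizers p c c'"
  shows "- inverse_chord_slope p x1 y2 \<le> (c' - b') / (c - b)"
    and "(c' - b') / (c - b) \<le> - inverse_chord_slope p y1 x2"
proof -
  have pow: "x1 ^ p < y2 ^ p" "y1 ^ p < x2 ^ p"
    using assms by (auto intro: power_strict_mono)
  have "(c - b) * x1 + (c' - b') * x1 ^ p \<le> (c - b) * y2 + (c' - b') * y2 ^ p"
    using assms by (intro maximizer_comparison)
  then have "(x1 - y2) * (c - b) \<le> (c' - b') * (y2 ^ p - x1 ^ p)"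
    by (simp add: algebra_simps)
  then show "- inverse_chord_slope p x1 y2 \<le> (c' - b') / (c - b)"
    using pow assms(2) unfolding inverse_chord_slope_def minus_divide_right
    by (simp add: divide_le_eq le_divide_eq mult.commute)
  have "(c - b) * x2 + (c' - b') * x2 ^ p \<le> (c - b) * y1 + (c' - b') * y1 ^ p"
    using assms by (intro maximizer_comparison)
  then have "(c' - b') * (x2 ^ p - y1 ^ p) \<le> (y1 - x2) * (c - b)"
    by (simp add: algebra_simps)
  then show "(c' - b') / (c - b) \<le> - inverse_chord_slope p y1 x2"
    using pow assms(2) unfolding inverse_chord_slope_def minus_divide_right
    by (simp add: divide_le_eq le_divide_eq mult.commute)
qed

text \<open>The factor \<open>(1 - t) * b\<close> cancels and leaves
  \<open>1 / (b ^ m * geo (Suc m) t)\<close>.\<close>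

lemma inverse_chord_slope_by_ratio:
  assumes "0 < t" "t < 1" "m \<ge> 1" "b = geo m t / geo (Suc m) t"
  shows "inverse_chord_slope (Suc m) (t * b) b = 1 / chord_slope m t"
proof -
  have pos: "geo m t > 0" "geo (Suc m) t > 0"
    using assms by (auto intro: geo_pos)
  have b: "b > 0"
    using pos assms by simp
  obtain n where n: "m = Suc n"
    using assms(3) by (cases m) auto
  have "t * b - b = - ((1 - t) * b)"
    by (simp add: algebra_simps)
  moreover have "(t * b) ^ Suc m - b ^ Suc m = - ((1 - t) * b * (b ^ m * geo (Suc m) t))"
  proof -
    have "(t * b) ^ Suc m - b ^ Suc m = - ((1 - t ^ Suc m) * (b * b ^ m))"
      by (simp add: power_mult_distrib algebra_simps)
    then show ?thesis
      unfolding one_minus_power_eq_geo by (simp only: mult_ac)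
  qed
  ultimately have "inverse_chord_slope (Suc m) (t * b) b = 1 / (b ^ m * geo (Suc m) t)"
    using b assms(2) unfolding inverse_chord_slope_def by (simp del: power_Suc)
  also have "b ^ m * geo (Suc m) t = chord_slope m t"
    using pos unfolding assms(4) chord_slope_def n by (simp add: power_divide)
  finally show ?thesis .
qed

section \<open>Continuity of the maximizers, derivative and convexity of q\<close>

locale transition_curve =
  fixes m :: nat and q X1 X2 :: "real \<Rightarrow> real"
  assumes m: "m \<ge> 1"
    and maximizers: "b < beta1_crit (Suc m) \<Longrightarrow> 0 < X1 b" "b < beta1_crit (Suc m) \<Longrightarrow> X1 b < real m / real (Suc m)"
      "b < beta1_crit (Suc m) \<Longrightarrow> real m / real (Suc m) < X2 b" "b < beta1_crit (Suc m) \<Longrightarrow> X2 b < 1"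
      "b < beta1_crit (Suc m) \<Longrightarrow> global_maximizers (Suc m) b (q b) = {X1 b, X2 b}"
begin

definition ratio :: "real \<Rightarrow> real" where
  "ratio b = X1 b / X2 b"

text \<open>One fixed point separates all smaller from all larger maximizers. Two parameters are
  allowed because the secant bounds use crossed pairs.\<close>

lemma X1_less_X2: "b < beta1_crit (Suc m) \<Longrightarrow> b' < beta1_crit (Suc m) \<Longrightarrow> X1 b < X2 b'"
  using maximizers(2)[of b] maximizers(3)[of b'] by linarith

lemma ratio_bounds:
  assumes "b < beta1_crit (Suc m)"
  shows "0 < ratio b" "ratio b < 1"
  using maximizers[OF assms] X1_less_X2[OF assms assms] unfolding ratio_def by auto

lemma
  assumes "b < beta1_crit (Suc m)"
  shows X2_eq: "X2 b = geo m (ratio b) / geo (Suc m) (ratio b)"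
    and beta1_of_ratio_ratio: "beta1_of_ratio m (ratio b) = b"
proof -
  have *: "X1 b < X2 b"
    by (intro X1_less_X2 assms)
  have eq: "ell (Suc m) b (q b) (X1 b) = ell (Suc m) b (q b) (X2 b)"
  proof -
    have "X1 b \<in> global_maximizers (Suc m) b (q b)" "X2 b \<in> global_maximizers (Suc m) b (q b)"
      using maximizers(5)[OF assms] by auto
    then show ?thesis
      unfolding global_maximizers_def is_arg_max_def by force
  qed
  note stat = stationary_of_maximizer[of _ m b "q b"]
  note pair = stationary_pair_by_ratio[OF m maximizers(1)[OF assms] * maximizers(4)[OF assms] stat stat eq]
  show "X2 b = geo m (ratio b) / geo (Suc m) (ratio b)" "beta1_of_ratio m (ratio b) = b"
    using pair * maximizers[OF assms] by (simp_all add: ratio_def)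
qed

lemma X1_eq: "b < beta1_crit (Suc m) \<Longrightarrow> X1 b = ratio b * X2 b"
  using maximizers(1)[of b] X1_less_X2[of b b] by (simp add: ratio_def)

lemma inverse_chord_slope_eq:
  "b < beta1_crit (Suc m) \<Longrightarrow> inverse_chord_slope (Suc m) (X1 b) (X2 b) = 1 / chord_slope m (ratio b)"
  using inverse_chord_slope_by_ratio[of "ratio b" m "X2 b"] ratio_bounds X2_eq X1_eq m by simp

text \<open>\<open>ratio\<close> is a right inverse of the injective \<open>beta1_of_ratio\<close>,
  hence also a left inverse.\<close>

lemma ratio_beta1_of_ratio:
  assumes "0 < t" "t < 1"
  shows "ratio (beta1_of_ratio m t) = t"
proof -
  have less: "beta1_of_ratio m t < beta1_crit (Suc m)"
    using assms m by (intro beta1_of_ratio_less_crit)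
  show ?thesis
    using beta1_of_ratio_ratio[OF less] ratio_bounds[OF less] assms
      beta1_of_ratio_strict_mono[OF m, of t "ratio (beta1_of_ratio m t)"]
      beta1_of_ratio_strict_mono[OF m, of "ratio (beta1_of_ratio m t)" t]
    by (cases t "ratio (beta1_of_ratio m t)" rule: linorder_cases) auto
qed

lemma ratio_mono:
  assumes "b \<le> c" "c < beta1_crit (Suc m)"
  shows "ratio b \<le> ratio c"
proof (rule ccontr)
  assume "\<not> ratio b \<le> ratio c"
  then have "beta1_of_ratio m (ratio c) < beta1_of_ratio m (ratio b)"
    using assms ratio_bounds[of b] ratio_bounds[of c] by (intro beta1_of_ratio_strict_mono m) auto
  then show False
    using assms beta1_of_ratio_ratio[of b] beta1_of_ratio_ratio[of c] by simp
qed

lemma isCont_ratio: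
  assumes "b < beta1_crit (Suc m)"
  shows "isCont ratio b"
proof -
  note t = ratio_bounds[OF assms]
  have "isCont ratio (beta1_of_ratio m (ratio b))"
    \<comment> \<open>The endpoints bound an interval inside (0,1) around
      \<open>ratio b\<close>.\<close>
    by (rule isCont_inverse_function2[of "ratio b / 2" _ "(1 + ratio b) / 2"])
      (use t m in \<open>auto intro!: ratio_beta1_of_ratio isCont_beta1_of_ratio\<close>)
  then show ?thesis
    by (simp add: beta1_of_ratio_ratio assms)
qed

lemma eventually_less_crit:
  assumes "b < beta1_crit (Suc m)"
  shows "eventually (\<lambda>c. c < beta1_crit (Suc m)) (nhds b)"
  using eventually_nhds_in_open[of "{..<beta1_crit (Suc m)}" b] assms by simp

lemma isCont_X:
  assumes "b < beta1_crit (Suc m)"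
  shows "isCont X1 b" "isCont X2 b"
proof -
  have geo: "isCont (geo k) x" for k x
    using continuous_on_geo[of UNIV k] by (simp add: continuous_on_eq_continuous_at)
  have "isCont (\<lambda>b. geo m (ratio b) / geo (Suc m) (ratio b)) b"
    using geo_pos[of "Suc m" "ratio b"] ratio_bounds[OF assms]
    by (intro continuous_intros isCont_o2[OF isCont_ratio[OF assms]] geo) auto
  moreover have "eventually (\<lambda>b. X2 b = geo m (ratio b) / geo (Suc m) (ratio b)) (nhds b)"
    using eventually_less_crit[OF assms] by eventually_elim (rule X2_eq)
  ultimately show X2: "isCont X2 b"
    using isCont_cong by fastforce
  have "isCont (\<lambda>b. ratio b * X2 b) b"
    by (intro continuous_intros isCont_ratio assms X2)
  moreover have "eventually (\<lambda>b. X1 b = ratio b * X2 b) (nhds b)"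
    using eventually_less_crit[OF assms] by eventually_elim (rule X1_eq)
  ultimately show "isCont X1 b"
    using isCont_cong by fastforce
qed

text \<open>The secant slope lies between the two crossed slopes; exchanging \<open>b\<close> and
  \<open>c\<close> only swaps the lower and the upper bound. The sum of distances covers both
  orders.\<close>

lemma secant_close:
  assumes "b < beta1_crit (Suc m)" "c < beta1_crit (Suc m)" "c \<noteq> b"
  defines "l \<equiv> - inverse_chord_slope (Suc m) (X1 b) (X2 b)"
  shows "\<bar>(q c - q b) / (c - b) - l\<bar> \<le>
    \<bar>- inverse_chord_slope (Suc m) (X1 b) (X2 c) - l\<bar> + \<bar>- inverse_chord_slope (Suc m) (X1 c) (X2 b) - l\<bar>"
proof -
  have mem: "X1 d \<in> global_maximizers (Suc m) d (q d)" "X2 d \<in> global_maximizers (Suc m) d (q d)" "0 \<le> X1 d"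
    if "d < beta1_crit (Suc m)" for d
    using maximizers(1,5)[OF that] by auto
  have between: "- inverse_chord_slope (Suc m) (X1 d) (X2 e) \<le> (q e - q d) / (e - d)"
    "(q e - q d) / (e - d) \<le> - inverse_chord_slope (Suc m) (X1 e) (X2 d)"
    if "d < e" "d < beta1_crit (Suc m)" "e < beta1_crit (Suc m)" for d e
    using secant_bounds[OF _ that(1) mem(3) X1_less_X2 mem(3) X1_less_X2 mem(1,2) mem(1,2)] that
    by simp_all
  have "(q b - q c) / (b - c) = (q c - q b) / (c - b)"
    by (metis minus_diff_eq minus_divide_divide)
  then show ?thesis
    using between[of b c] between[of c b] assms by (cases "b < c") auto
qed

text \<open>Both crossed slopes tend to \<open>l\<close> as \<open>c\<close> tends to
  \<open>b\<close>, by continuity of \<open>X1\<close> and \<open>X2\<close>, and squeeze the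
  difference quotient.\<close>

lemma q_has_derivative:
  assumes "b < beta1_crit (Suc m)"
  shows "(q has_real_derivative - inverse_chord_slope (Suc m) (X1 b) (X2 b)) (at b)"
proof -
  define l where "l = - inverse_chord_slope (Suc m) (X1 b) (X2 b)"
  have "X1 b ^ Suc m < X2 b ^ Suc m"
    using maximizers(1)[OF assms] X1_less_X2[OF assms assms] by (intro power_strict_mono) auto
  then have "((\<lambda>c. \<bar>- inverse_chord_slope (Suc m) (X1 b) (X2 c) - l\<bar> + \<bar>- inverse_chord_slope (Suc m) (X1 c) (X2 b) - l\<bar>)
      \<longlongrightarrow> \<bar>l - l\<bar> + \<bar>l - l\<bar>) (at b)"
    using isCont_X[OF assms] unfolding isCont_def l_def inverse_chord_slope_def
    by (intro tendsto_intros) auto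
  then have 0: "((\<lambda>c. \<bar>- inverse_chord_slope (Suc m) (X1 b) (X2 c) - l\<bar> + \<bar>- inverse_chord_slope (Suc m) (X1 c) (X2 b) - l\<bar>)
      \<longlongrightarrow> 0) (at b)"
    by simp
  have "eventually (\<lambda>c. c \<noteq> b \<and> c < beta1_crit (Suc m)) (at b)"
    using eventually_less_crit[OF assms] by (auto simp: eventually_at_filter elim: eventually_mono)
  then have "eventually (\<lambda>c. norm ((q c - q b) / (c - b) - l) \<le>
      \<bar>- inverse_chord_slope (Suc m) (X1 b) (X2 c) - l\<bar> + \<bar>- inverse_chord_slope (Suc m) (X1 c) (X2 b) - l\<bar>) (at b)"
    by eventually_elim (use secant_close[OF assms] in \<open>auto simp: l_def\<close>)
  then have "((\<lambda>c. (q c - q b) / (c - b) - l) \<longlongrightarrow> 0) (at b)"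
    using 0 by (rule Lim_null_comparison)
  then show ?thesis
    unfolding has_field_derivative_iff l_def[symmetric] by (simp add: LIM_zero_iff)
qed

lemma deriv_q: "b < beta1_crit (Suc m) \<Longrightarrow> deriv q b = - (1 / chord_slope m (ratio b))"
  using DERIV_imp_deriv[OF q_has_derivative] inverse_chord_slope_eq by simp

lemma convex_q: "convex_on {..<beta1_crit (Suc m)} q"
proof (rule convex_on_realI)
  show "(q has_real_derivative - (1 / chord_slope m (ratio b))) (at b)"
    if "b \<in> {..<beta1_crit (Suc m)}" for b
    using q_has_derivative[of b] inverse_chord_slope_eq[of b] that by simp
  show "- (1 / chord_slope m (ratio b)) \<le> - (1 / chord_slope m (ratio c))"
    if "b \<in> {..<beta1_crit (Suc m)}" "c \<in> {..<beta1_crit (Suc m)}" "b \<le> c" for b c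
    using that ratio_bounds[of b] ratio_bounds[of c] ratio_mono[of b c] m
      chord_slope_pos[OF m, of "ratio b"] chord_slope_pos[OF m, of "ratio c"]
      chord_slope_mono[OF m, of "ratio b" "ratio c"]
    by (simp add: frac_le)
qed (simp add: is_interval_connected)

section \<open>The two limits of the derivative\<close>

text \<open>A general filter serves both limits: \<open>t = 1\<close> at the critical point and
  \<open>t = 0\<close> at minus infinity.\<close>

lemma deriv_q_tendsto:
  assumes "(ratio \<longlongrightarrow> t) F" "0 \<le> t" "eventually (\<lambda>b. b < beta1_crit (Suc m)) F"
  shows "(deriv q \<longlongrightarrow> - (1 / chord_slope m t)) F"
proof -
  have "eventually (\<lambda>b. ratio b \<in> {0..}) F"
    using assms(3) by eventually_elim (use ratio_bounds in \<open>auto intro: less_imp_le\<close>)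
  then have "((\<lambda>b. chord_slope m (ratio b)) \<longlongrightarrow> chord_slope m t) F"
    using assms by (intro continuous_on_tendsto_compose[OF continuous_on_chord_slope]) auto
  then have "((\<lambda>b. - (1 / chord_slope m (ratio b))) \<longlongrightarrow> - (1 / chord_slope m t)) F"
    using chord_slope_pos[OF m assms(2)] by (intro tendsto_intros) auto
  moreover have "eventually (\<lambda>b. - (1 / chord_slope m (ratio b)) = deriv q b) F"
    using assms(3) by eventually_elim (simp add: deriv_q)
  ultimately show ?thesis
    by (rule Lim_transform_eventually)
qed

lemma ratio_tendsto_crit: "(ratio \<longlongrightarrow> 1) (at_left (beta1_crit (Suc m)))"
proof (rule order_tendstoI)
  have less: "eventually (\<lambda>b. b < beta1_crit (Suc m)) (at_left (beta1_crit (Suc m)))"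
    by (simp add: eventually_at_filter)
  show "eventually (\<lambda>b. ratio b < a) (at_left (beta1_crit (Suc m)))" if "1 < a" for a
    using less by eventually_elim (use ratio_bounds that in force)
  show "eventually (\<lambda>b. a < ratio b) (at_left (beta1_crit (Suc m)))" if "a < 1" for a
  proof -
    \<comment> \<open>The maximum with 0 keeps \<open>s\<close> positive for negative
      \<open>a\<close>; beyond \<open>beta1_of_ratio m s\<close> the ratio is at least
      \<open>s\<close>.\<close>
    define s where "s = (max a 0 + 1) / 2"
    have s: "0 < s" "s < 1" "a < s"
      using that by (auto simp: s_def)
    have "eventually (\<lambda>b. b \<in> {beta1_of_ratio m s<..<beta1_crit (Suc m)}) (at_left (beta1_crit (Suc m)))"
      using beta1_of_ratio_less_crit[OF m s(1,2)] by (intro eventually_at_left_real)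
    then show ?thesis
    proof eventually_elim
      case (elim b)
      then have "s \<le> ratio b"
        using ratio_mono[of "beta1_of_ratio m s" b] ratio_beta1_of_ratio[OF s(1,2)] by simp
      then show ?case
        using s by simp
    qed
  qed
qed

lemma ratio_tendsto_at_bot: "(ratio \<longlongrightarrow> 0) at_bot"
proof (rule tendsto_sandwich)
  have less: "eventually (\<lambda>b. b < beta1_crit (Suc m)) at_bot"
    by (rule eventually_gt_at_bot)
  show "eventually (\<lambda>b. 0 \<le> ratio b) at_bot"
    using less by eventually_elim (use ratio_bounds in \<open>auto intro: less_imp_le\<close>)
  show "eventually (\<lambda>b. ratio b \<le> exp (real (Suc m)) * exp b) at_bot"
    using less
  proof eventually_elim
    case (elim b)
    have "ln (ratio b) \<le> real (Suc m) + b"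
      using beta1_of_ratio_lower[OF m ratio_bounds[OF elim]] beta1_of_ratio_ratio[OF elim] by simp
    then show ?case
      using ratio_bounds[OF elim] by (metis exp_add exp_le_cancel_iff exp_ln)
  qed
  show "((\<lambda>b. exp (real (Suc m)) * exp b) \<longlongrightarrow> 0) at_bot"
    by (intro tendsto_mult_right_zero exp_at_bot)
qed auto

end

section \<open>Transfer to p and to an arbitrary ordered pair of maximizers\<close>

theorem theorem3:
  fixes p :: nat and q :: "real \<Rightarrow> real"
  assumes "p \<ge> 2"
    and "phase_transition_curve p q"
  shows "(\<forall>\<beta>1 < beta1_crit p. \<forall>x1 x2.
             x1 < x2 \<and> global_maximizers p \<beta>1 (q \<beta>1) = {x1, x2} \<longrightarrow>
               (q has_real_derivative - ((x1 - x2) / (x1 ^ p - x2 ^ p))) (at \<beta>1) \<and>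
               - ((x1 - x2) / (x1 ^ p - x2 ^ p)) < 0)
         \<and> (deriv q \<longlongrightarrow> - (real p ^ (p - 2) / (real p - 1) ^ (p - 1))) (at_left (beta1_crit p))
         \<and> (deriv q \<longlongrightarrow> - 1) at_bot
         \<and> convex_on {..<beta1_crit p} q"
proof -
  obtain m where p: "p = Suc m" and m: "m \<ge> 1"
    using assms(1) by (cases p) auto
  have "\<exists>x1 x2. 0 < x1 \<and> x1 < real m / real (Suc m) \<and> real m / real (Suc m) < x2 \<and> x2 < 1 \<and>
      global_maximizers (Suc m) b (q b) = {x1, x2}" if "b < beta1_crit (Suc m)" for b
  proof -
    have "(real p - 1) / real p = real m / real (Suc m)"
      by (simp add: p)
    then show ?thesis
      using assms(2) that unfolding phase_transition_curve_def p by metis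
  qed
  then obtain X1 X2 where "\<And>b. b < beta1_crit (Suc m) \<Longrightarrow>
      0 < X1 b \<and> X1 b < real m / real (Suc m) \<and> real m / real (Suc m) < X2 b \<and> X2 b < 1 \<and>
      global_maximizers (Suc m) b (q b) = {X1 b, X2 b}"
    by metis
  then interpret transition_curve m q X1 X2
    using m by unfold_locales auto
  have "(q has_real_derivative - ((x1 - x2) / (x1 ^ p - x2 ^ p))) (at b) \<and>
      - ((x1 - x2) / (x1 ^ p - x2 ^ p)) < 0"
    if b: "b < beta1_crit p" and x: "x1 < x2" "global_maximizers p b (q b) = {x1, x2}" for b x1 x2
  proof -
    have b': "b < beta1_crit (Suc m)"
      using b by (simp add: p)
    have "x1 = X1 b" "x2 = X2 b"
      using x maximizers(5)[OF b'] X1_less_X2[OF b' b'] by (auto simp: p doubleton_eq_iff)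
    then have "- ((x1 - x2) / (x1 ^ p - x2 ^ p)) = - inverse_chord_slope (Suc m) (X1 b) (X2 b)"
      by (simp add: inverse_chord_slope_def p)
    then show ?thesis
      using q_has_derivative[OF b'] inverse_chord_slope_eq[OF b'] ratio_bounds[OF b']
        chord_slope_pos[OF m, of "ratio b"] by simp
  qed
  \<comment> \<open>The chord slope at ratio 1 is \<open>m ^ m / (m + 1) ^ (m - 1)\<close>, and at
    ratio 0 it is 1.\<close>
  moreover have "(deriv q \<longlongrightarrow> - (real p ^ (p - 2) / (real p - 1) ^ (p - 1))) (at_left (beta1_crit p))"
    using deriv_q_tendsto[OF ratio_tendsto_crit]
    by (simp add: p chord_slope_def eventually_at_filter)
  moreover have "(deriv q \<longlongrightarrow> - 1) at_bot"
    using deriv_q_tendsto[OF ratio_tendsto_at_bot _ eventually_gt_at_bot] m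
    by (simp add: chord_slope_def geo_at_zero)
  moreover have "convex_on {..<beta1_crit p} q"
    using convex_q by (simp add: p)
  ultimately show ?thesis
    by blast
qed

end
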